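(* For every formula $\phi$: $\phi$ is derivable in the natural deduction system $\mathsf{NK}^\pm$ from no assumptions if and only if $\phi$ is a classical tautology, i.e. $v(\phi)=1$ for every valuation $v$.
   Context: Let $\mathbb{C}$ be a denumerable set of contents and $\mathbb{L} = \{c^+, c^- : c \in \mathbb{C}\}$ the set of literals. Formulas: every literal; $\bot$; $\top$; and $\phi\land\psi$, $\phi\lor\psi$, $\phi\to\psi$ for formulas $\phi,\psi$. Duality $(-)^\bot$: $(c^+)^\bot = c^-$, $(c^-)^\bot = c^+$, $\bot^\bot=\top$, $\top^\bot=\bot$, $(\phi\land\psi)^\bot=\phi^\bot\lor\psi^\bot$, $(\phi\lor\psi)^\bot=\phi^\bot\land\psi^\bot$, $(\phi\to\psi)^\bot=\phi\land\psi^\bot$. A valuation is $v:\mathbb{L}\to\{0,1\}$ with $v(c^-)=1-v(c^+)$, extended by $v(\bot)=0$, $v(\top)=1$, $v(\phi\land\psi)=\min$, $v(\phi\lor\psi)=\max$, $v(\phi\to\psi)=\max\{1-v(\phi),v(\psi)\}$. The system $\mathsf{NK}^\pm$ is the Gentzen-style natural deduction system (with assumption discharge) with rules: $\top$-introduction (infer $\top$ from nothing); $\bot$-elimination (from $\bot$ infer any $\phi$); $\to$-introduction (from a derivation of $\psi$ from assumption $[\phi]$, infer $\phi\to\psi$, discharging $\phi$); $\to$-elimination (from $\phi\to\psi$ and $\phi$ infer $\psi$); $\land$-introduction (from $\phi$ and $\psi$ infer $\phi\land\psi$); $\land$-eliminations (from $\phi_1\land\phi_2$ infer $\phi_1$,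 resp. $\phi_2$); $\lor$-introductions (from $\phi_1$, resp. $\phi_2$, infer $\phi_1\lor\phi_2$); $\lor$-elimination (from $\phi_1\lor\phi_2$, a derivation of $\psi$ from $[\phi_1]$ and a derivation of $\psi$ from $[\phi_2]$, infer $\psi$, discharging); DM (from a derivation of $\bot$ from assumption $[\phi]$, infer $\phi^\bot$, discharging $\phi$); EXC (from $\phi$ and $\phi^\bot$ infer $\bot$). *)

theory Defs
  imports Main "HOL-Library.Countable_Set"
begin

datatype 'c literal = Pos 'c | Neg 'c

datatype 'c formula =
    Lit "'c literal"
  | Falsum
  | Verum
  | And "'c formula" "'c formula"  (infixr "\<^bold>\<and>" 75)
  | Or "'c formula" "'c formula"  (infixr "\<^bold>\<or>" 70)
  | Imp "'c formula" "'c formula"  (infixr "\<^bold>\<rightarrow>" 65)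

fun dual :: "'c formula \<Rightarrow> 'c formula" where
  "dual (Lit (Pos c)) = Lit (Neg c)"
| "dual (Lit (Neg c)) = Lit (Pos c)"
| "dual Falsum = Verum"
| "dual Verum = Falsum"
| "dual (\<phi> \<^bold>\<and> \<psi>) = dual \<phi> \<^bold>\<or> dual \<psi>"
| "dual (\<phi> \<^bold>\<or> \<psi>) = dual \<phi> \<^bold>\<and> dual \<psi>"
| "dual (\<phi> \<^bold>\<rightarrow> \<psi>) = \<phi> \<^bold>\<and> dual \<psi>"

definition valuation :: "('c literal \<Rightarrow> int) \<Rightarrow> bool" where
  "valuation v \<longleftrightarrow> (\<forall>l. v l \<in> {0, 1}) \<and> (\<forall>c. v (Neg c) = 1 - v (Pos c))"

fun val :: "('c literal \<Rightarrow> int) \<Rightarrow> 'c formula \<Rightarrow> int" where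
  "val v (Lit l) = v l"
| "val v Falsum = 0"
| "val v Verum = 1"
| "val v (\<phi> \<^bold>\<and> \<psi>) = min (val v \<phi>) (val v \<psi>)"
| "val v (\<phi> \<^bold>\<or> \<psi>) = max (val v \<phi>) (val v \<psi>)"
| "val v (\<phi> \<^bold>\<rightarrow> \<psi>) = max (1 - val v \<phi>) (val v \<psi>)"

definition tautology :: "'c formula \<Rightarrow> bool" where
  "tautology \<phi> \<longleftrightarrow> (\<forall>v. valuation v \<longrightarrow> val v \<phi> = 1)"

(* NK G phi: there is a derivation tree with conclusion phi all of whose open (undischarged)
   assumptions belong to G. As usual in Gentzen-style systems, a rule may discharge any number
   of occurrences of the indicated assumption, including none. *)
inductive NK :: "'c formula set \<Rightarrow> 'c formula \<Rightarrow> bool"  (infix "\<turnstile>" 50) where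
  assumption: "\<phi> \<in> \<Gamma> \<Longrightarrow> \<Gamma> \<turnstile> \<phi>"
| VerumI: "\<Gamma> \<turnstile> Verum"
| FalsumE: "\<Gamma> \<turnstile> Falsum \<Longrightarrow> \<Gamma> \<turnstile> \<phi>"
| ImpI: "insert \<phi> \<Gamma> \<turnstile> \<psi> \<Longrightarrow> \<Gamma> \<turnstile> \<phi> \<^bold>\<rightarrow> \<psi>"
| ImpE: "\<Gamma> \<turnstile> \<phi> \<^bold>\<rightarrow> \<psi> \<Longrightarrow> \<Gamma> \<turnstile> \<phi> \<Longrightarrow> \<Gamma> \<turnstile> \<psi>"
| AndI: "\<Gamma> \<turnstile> \<phi> \<Longrightarrow> \<Gamma> \<turnstile> \<psi> \<Longrightarrow> \<Gamma> \<turnstile> \<phi> \<^bold>\<and> \<psi>"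
| AndE1: "\<Gamma> \<turnstile> \<phi>\<^sub>1 \<^bold>\<and> \<phi>\<^sub>2 \<Longrightarrow> \<Gamma> \<turnstile> \<phi>\<^sub>1"
| AndE2: "\<Gamma> \<turnstile> \<phi>\<^sub>1 \<^bold>\<and> \<phi>\<^sub>2 \<Longrightarrow> \<Gamma> \<turnstile> \<phi>\<^sub>2"
| OrI1: "\<Gamma> \<turnstile> \<phi>\<^sub>1 \<Longrightarrow> \<Gamma> \<turnstile> \<phi>\<^sub>1 \<^bold>\<or> \<phi>\<^sub>2"
| OrI2: "\<Gamma> \<turnstile> \<phi>\<^sub>2 \<Longrightarrow> \<Gamma> \<turnstile> \<phi>\<^sub>1 \<^bold>\<or> \<phi>\<^sub>2"
| OrE: "\<Gamma> \<turnstile> \<phi>\<^sub>1 \<^bold>\<or> \<phi>\<^sub>2 \<Longrightarrow> insert \<phi>\<^sub>1 \<Gamma> \<turnstile> \<psi> \<Longrightarrow> insert \<phi>\<^sub>2 \<Gamma> \<turnstile> \<psi> \<Longrightarrow> \<Gamma> \<turnstile> \<psi>"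
| DM: "insert \<phi> \<Gamma> \<turnstile> Falsum \<Longrightarrow> \<Gamma> \<turnstile> dual \<phi>"
| EXC: "\<Gamma> \<turnstile> \<phi> \<Longrightarrow> \<Gamma> \<turnstile> dual \<phi> \<Longrightarrow> \<Gamma> \<turnstile> Falsum"

end

(* Completeness follows Kalmar: the literals true under v, restricted to the contents occurring
   in a formula, derive the formula or its dual according to its value under v. For a tautology,
   the literal assumptions are then removed one content c at a time by case analysis on
   c+ \<or> c-, which DM yields directly because it is the dual of c- \<and> c+. *)
theory Submission
  imports Defs
begin

text \<open>Values are integers, so \<open>min\<close>, \<open>max\<close> and \<open>1 - x\<close>
  act as Boolean connectives only on 0 and 1; the case splits below rest on this.\<close>

lemma val_cases:
  assumes "valuation v"
  shows "val v \<phi> = 0 \<or> val v \<phi> = 1"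
  using assms by (induction \<phi>) (auto simp: valuation_def)

lemma val_dual:
  assumes "valuation v"
  shows "val v (dual \<phi>) = 1 - val v \<phi>"
  using assms by (induction \<phi> rule: dual.induct) (auto simp: valuation_def)

lemma NK_sound:
  assumes "\<Gamma> \<turnstile> \<phi>" and "valuation v" and "\<forall>\<gamma>\<in>\<Gamma>. val v \<gamma> = 1"
  shows "val v \<phi> = 1"
  using assms
proof (induction rule: NK.induct)
  case (ImpI \<phi> \<Gamma> \<psi>)
  then show ?case using val_cases[of v \<phi>] val_cases[of v \<psi>] by auto
next
  case (ImpE \<Gamma> \<phi> \<psi>)
  then show ?case using val_cases[of v \<psi>] by auto
next
  case (AndE1 \<Gamma> \<phi> \<psi>)
  then show ?case using val_cases[of v \<phi>] val_cases[of v \<psi>] by auto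
next
  case (AndE2 \<Gamma> \<phi> \<psi>)
  then show ?case using val_cases[of v \<phi>] val_cases[of v \<psi>] by auto
next
  case (OrI1 \<Gamma> \<phi> \<psi>)
  then show ?case using val_cases[of v \<psi>] by auto
next
  case (OrI2 \<Gamma> \<psi> \<phi>)
  then show ?case using val_cases[of v \<phi>] by auto
next
  case (OrE \<Gamma> \<phi> \<psi> \<chi>)
  then show ?case using val_cases[of v \<phi>] val_cases[of v \<psi>] by auto
next
  case (DM \<phi> \<Gamma>)
  \<comment> \<open>Were \<phi> to have value 1, the induction hypothesis would give
    \<open>Falsum\<close> value 1; so \<phi> has value 0 and its dual value 1.\<close>
  then show ?case using val_cases[of v \<phi>] by (auto simp: val_dual)
next
  case (EXC \<Gamma> \<phi>)
  then show ?case by (auto simp: val_dual)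
qed auto

text \<open>\<Delta> is generalised because the discharging rules enlarge the context, so the
  hypothesis is used at \<open>insert \<phi> \<Delta>\<close>.\<close>

lemma NK_weaken:
  assumes "\<Gamma> \<turnstile> \<phi>" and "\<Gamma> \<subseteq> \<Delta>"
  shows "\<Delta> \<turnstile> \<phi>"
  using assms
proof (induction arbitrary: \<Delta> rule: NK.induct)
  case (ImpI \<phi> \<Gamma> \<psi>)
  then show ?case by (meson NK.ImpI insert_mono)
next
  case (OrE \<Gamma> \<phi> \<psi> \<chi>)
  then show ?case by (meson NK.OrE insert_mono)
next
  case (DM \<phi> \<Gamma>)
  then show ?case by (meson NK.DM insert_mono)
next
  case (EXC \<Gamma> \<phi>)
  then show ?case by (blast intro: NK.EXC)
qed (blast intro: assumption VerumI FalsumE ImpE AndI AndE1 AndE2 OrI1 OrI2)+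

lemma NK_excluded_middle: "\<Gamma> \<turnstile> Lit (Pos c) \<^bold>\<or> Lit (Neg c)"
proof -
  let ?N = "Lit (Neg c) \<^bold>\<and> Lit (Pos c)"
  have N: "insert ?N \<Gamma> \<turnstile> ?N"
    by (simp add: assumption)
  have "insert ?N \<Gamma> \<turnstile> dual (Lit (Neg c))"
    using AndE2[OF N] by simp
  then have "insert ?N \<Gamma> \<turnstile> Falsum"
    by (rule EXC[OF AndE1[OF N]])
  then show ?thesis
    using DM[of ?N \<Gamma>] by simp
qed

text \<open>The bound \<open>A\<close> on contents is what the later induction shrinks to the empty
  set.\<close>

definition true_literals :: "('c literal \<Rightarrow> int) \<Rightarrow> 'c set \<Rightarrow> 'c formula set" where
  "true_literals v A = {Lit l |l. v l = 1 \<and> set_literal l \<subseteq> A}"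

lemma true_literals_Un_subsetD:
  assumes "true_literals v (A \<union> B) \<subseteq> \<Gamma>"
  shows "true_literals v A \<subseteq> \<Gamma>" and "true_literals v B \<subseteq> \<Gamma>"
  using assms unfolding true_literals_def by blast+

text \<open>Allowing any \<Gamma> above the true literals lets both immediate subformulas use the
  same context as the whole formula.\<close>

lemma Kalmar:
  assumes v: "valuation v" and "true_literals v (set_formula \<phi>) \<subseteq> \<Gamma>"
  shows "(val v \<phi> = 1 \<longrightarrow> \<Gamma> \<turnstile> \<phi>) \<and> (val v \<phi> = 0 \<longrightarrow> \<Gamma> \<turnstile> dual \<phi>)"
  using assms(2)
proof (induction \<phi>)
  case (Lit l)
  \<comment> \<open>Stated for every \<open>l'\<close> over the same content: if \<open>l\<close> is
    false, its opposite is the true literal found in \<Gamma>.\<close>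
  then have "v l' = 1 \<Longrightarrow> set_literal l' \<subseteq> set_literal l \<Longrightarrow> \<Gamma> \<turnstile> Lit l'" for l'
    by (auto simp: true_literals_def intro!: assumption)
  with v show ?case
    by (cases l) (auto simp: valuation_def)
next
  case Falsum
  then show ?case by (simp add: VerumI)
next
  case Verum
  then show ?case by (simp add: VerumI)
next
  case (And \<phi> \<psi>)
  have "true_literals v (set_formula \<phi>) \<subseteq> \<Gamma>" "true_literals v (set_formula \<psi>) \<subseteq> \<Gamma>"
    using true_literals_Un_subsetD[of v "set_formula \<phi>" "set_formula \<psi>" \<Gamma>] And.prems by simp_all
  with And.IH show ?case
    using val_cases[OF v, of \<phi>] val_cases[OF v, of \<psi>] by (auto intro: AndI OrI1 OrI2)
next
  case (Or \<phi> \<psi>)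
  have "true_literals v (set_formula \<phi>) \<subseteq> \<Gamma>" "true_literals v (set_formula \<psi>) \<subseteq> \<Gamma>"
    using true_literals_Un_subsetD[of v "set_formula \<phi>" "set_formula \<psi>" \<Gamma>] Or.prems by simp_all
  with Or.IH show ?case
    using val_cases[OF v, of \<phi>] val_cases[OF v, of \<psi>] by (auto intro: AndI OrI1 OrI2)
next
  case (Imp \<phi> \<psi>)
  have "true_literals v (set_formula \<phi>) \<subseteq> \<Gamma>" "true_literals v (set_formula \<psi>) \<subseteq> \<Gamma>"
    using true_literals_Un_subsetD[of v "set_formula \<phi>" "set_formula \<psi>" \<Gamma>] Imp.prems by simp_all
  note IH = Imp.IH(1)[OF this(1)] Imp.IH(2)[OF this(2)]
  \<comment> \<open>False antecedent: assuming \<phi> contradicts its dual, and \<psi> follows ex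
    falso.\<close>
  have "\<Gamma> \<turnstile> \<phi> \<^bold>\<rightarrow> \<psi>" if "\<Gamma> \<turnstile> dual \<phi>"
  proof (rule ImpI, rule FalsumE, rule EXC)
    show "insert \<phi> \<Gamma> \<turnstile> \<phi>" by (simp add: assumption)
    show "insert \<phi> \<Gamma> \<turnstile> dual \<phi>" using that by (rule NK_weaken) auto
  qed
  moreover have "\<Gamma> \<turnstile> \<phi> \<^bold>\<rightarrow> \<psi>" if "\<Gamma> \<turnstile> \<psi>"
    using NK_weaken[OF that] by (blast intro: ImpI)
  ultimately show ?case
    using IH val_cases[OF v, of \<phi>] val_cases[OF v, of \<psi>] by (auto intro: AndI)
qed

text \<open>The premise ranges over all valuations, so the induction step may apply it to variants
  of \<open>v\<close> that differ at \<open>c\<close>.\<close>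

lemma NK_eliminate_literals:
  assumes "finite A" and "\<And>v. valuation v \<Longrightarrow> true_literals v A \<turnstile> \<phi>"
  shows "{} \<turnstile> \<phi>"
  using assms
proof (induction A)
  case empty
  \<comment> \<open>Some valuation is needed to instantiate the premise; this one makes all positive
    literals true.\<close>
  have "valuation (case_literal (\<lambda>_. 1) (\<lambda>_. 0))"
    by (auto simp: valuation_def split: literal.splits)
  moreover have "true_literals v {} = {}" for v :: "'a literal \<Rightarrow> int"
  proof -
    have "set_literal l \<noteq> {}" for l :: "'a literal"
      by (cases l) auto
    then show ?thesis
      by (simp add: true_literals_def)
  qed
  ultimately show ?case
    using empty by metis
next
  case (insert c A)
  have "true_literals v A \<turnstile> \<phi>" if v: "valuation v" for v
  proof -
    \<comment> \<open>Both variants agree with \<open>v\<close> away from \<open>c\<close>, so each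
      adds at most one literal on \<open>c\<close> to those of \<open>v\<close> over
      \<open>A\<close>; \<open>OrE\<close> then discharges these two literals.\<close>
    let ?p = "v(Pos c := 1, Neg c := 0)" and ?n = "v(Pos c := 0, Neg c := 1)"
    have "valuation ?p" "valuation ?n"
      using v by (auto simp: valuation_def)
    then have "true_literals ?p (insert c A) \<turnstile> \<phi>" "true_literals ?n (insert c A) \<turnstile> \<phi>"
      using insert.prems by blast+
    moreover have "true_literals ?p (insert c A) \<subseteq> insert (Lit (Pos c)) (true_literals v A)"
    proof
      fix x assume "x \<in> true_literals ?p (insert c A)"
      then obtain l where "x = Lit l" "?p l = 1" "set_literal l \<subseteq> insert c A"
        by (auto simp: true_literals_def)
      then show "x \<in> insert (Lit (Pos c)) (true_literals v A)"
        by (cases l) (auto simp: true_literals_def split: if_splits)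
    qed
    moreover have "true_literals ?n (insert c A) \<subseteq> insert (Lit (Neg c)) (true_literals v A)"
    proof
      fix x assume "x \<in> true_literals ?n (insert c A)"
      then obtain l where "x = Lit l" "?n l = 1" "set_literal l \<subseteq> insert c A"
        by (auto simp: true_literals_def)
      then show "x \<in> insert (Lit (Neg c)) (true_literals v A)"
        by (cases l) (auto simp: true_literals_def split: if_splits)
    qed
    ultimately have "insert (Lit (Pos c)) (true_literals v A) \<turnstile> \<phi>"
        and "insert (Lit (Neg c)) (true_literals v A) \<turnstile> \<phi>"
      by (simp_all only: NK_weaken)
    then show ?thesis by (rule OrE[OF NK_excluded_middle])
  qed
  then show ?case by (rule insert.IH)
qed

lemma NK_complete:
  assumes "tautology \<phi>"
  shows "{} \<turnstile> \<phi>"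
proof (rule NK_eliminate_literals)
  show "finite (set_formula \<phi>)"
  proof (induction \<phi>)
    case (Lit l)
    then show ?case by (cases l) auto
  qed auto
  show "true_literals v (set_formula \<phi>) \<turnstile> \<phi>" if "valuation v" for v
    \<comment> \<open>\<open>order_refl\<close> takes the true literals themselves as context; being
      a tautology selects the value 1 half.\<close>
    using Kalmar[OF that order_refl] that assms by (auto simp: tautology_def)
qed

theorem mainTheorem2:
  fixes \<phi> :: "'c formula"
  assumes "countable (UNIV :: 'c set)" and "infinite (UNIV :: 'c set)"
  shows "{} \<turnstile> \<phi> \<longleftrightarrow> tautology \<phi>"
  using NK_sound[of "{}" \<phi>] NK_complete[of \<phi>] by (auto simp: tautology_def)

end
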